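(* Let $\alpha\ge 2$ be an integer and let $m$ be an odd positive integer. Then $$I(2^\alpha m)\ \ge\ \frac{(2^\alpha m)^2\,(3m\,2^\alpha+2^\alpha-4)}{16}.$$
   Context: A Latin square of order $n$ is an $n\times n$ array with entries from a set of $n$ symbols such that each symbol occurs exactly once in each row and exactly once in each column; it is identified with the set of triples $(i,j;k)$ meaning that symbol $k$ occurs in row $i$, column $j$. An intercalate in a Latin square $L$ is a $2\times 2$ subsquare of $L$, i.e. a set of four entries $\{(r_1,c_1;e_1),(r_1,c_2;e_2),(r_2,c_1;e_2),(r_2,c_2;e_1)\}\subseteq L$ with $r_1\ne r_2$, $c_1\ne c_2$, $e_1\neq e_2$. $I(L)$ is the number of intercalates in $L$ (counted as sets of entries), and $I(n)$ is the maximum of $I(L)$ over all Latin squares $L$ of order $n$. *)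

theory Defs
  imports Complex_Main
begin

text \<open>A Latin square of order \<open>n\<close> on the symbol set \<open>S\<close>, given by its set of triples
  (row, column, symbol); rows and columns are indexed by \<open>{..<n}\<close>. The clause on \<open>i\<close>, \<open>j\<close>
  says that \<open>L\<close> is an array, i.e. that each cell contains exactly one symbol.\<close>

definition latin_square :: "nat \<Rightarrow> 'a set \<Rightarrow> (nat \<times> nat \<times> 'a) set \<Rightarrow> bool" where
  "latin_square n S L \<longleftrightarrow>
     finite S \<and> card S = n \<and> L \<subseteq> {..<n} \<times> {..<n} \<times> S \<and>
     (\<forall>i<n. \<forall>j<n. \<exists>!k. (i, j, k) \<in> L) \<and>
     (\<forall>i<n. \<forall>k\<in>S. \<exists>!j. (i, j, k) \<in> L) \<and>
     (\<forall>j<n. \<forall>k\<in>S. \<exists>!i. (i, j, k) \<in> L)"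

definition intercalates :: "(nat \<times> nat \<times> 'a) set \<Rightarrow> (nat \<times> nat \<times> 'a) set set" where
  "intercalates L = {Q. Q \<subseteq> L \<and>
     (\<exists>r1 r2 c1 c2 e1 e2. r1 \<noteq> r2 \<and> c1 \<noteq> c2 \<and> e1 \<noteq> e2 \<and>
        Q = {(r1, c1, e1), (r1, c2, e2), (r2, c1, e2), (r2, c2, e1)})}"

definition num_intercalates :: "(nat \<times> nat \<times> 'a) set \<Rightarrow> nat" where
  "num_intercalates L = card (intercalates L)"

text \<open>Symbol sets range over the \<open>n\<close>-element sets of natural numbers; this is no restriction, since
  renaming symbols preserves the number of intercalates.\<close>

definition max_intercalates :: "nat \<Rightarrow> nat" where
  "max_intercalates n = Max {num_intercalates L | L (S :: nat set). latin_square n S L}"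

text \<open>The maximum is taken over a finite nonempty set, as \<^const>\<open>Max\<close> requires.\<close>

lemma finite_num_intercalates:
  "finite {num_intercalates L | L (S :: nat set). latin_square n S L}"
proof (rule finite_subset)
  show "{num_intercalates L | L (S :: nat set). latin_square n S L} \<subseteq> {..2 ^ (n * (n * n))}"
  proof clarify
    fix L and S :: "nat set"
    assume L: "latin_square n S L"
    let ?U = "{..<n} \<times> {..<n} \<times> S"
    have U: "finite ?U" "card ?U = n * (n * n)"
      using L by (auto simp: latin_square_def card_cartesian_product)
    have "intercalates L \<subseteq> Pow ?U"
      using L by (auto simp: latin_square_def intercalates_def)
    then have "card (intercalates L) \<le> card (Pow ?U)"
      using U(1) by (intro card_mono) auto
    then show "num_intercalates L \<le> 2 ^ (n * (n * n))"
      using U by (simp add: num_intercalates_def card_Pow)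
  qed
qed simp

lemma cyclic_unique:
  fixes n i k :: nat
  assumes "i < n" "k < n"
  shows "\<exists>!j. j < n \<and> (i + j) mod n = k"
proof (rule ex1I)
  let ?j = "if i \<le> k then k - i else n + k - i"
  show "?j < n \<and> (i + ?j) mod n = k" using assms by auto
  show "j = ?j" if j: "j < n \<and> (i + j) mod n = k" for j
  proof (cases "i + j < n")
    case True
    then show ?thesis using j by auto
  next
    case False
    then have "(i + j) mod n = i + j - n"
      using j assms(1) le_mod_geq[of n "i + j"] mod_less[of "i + j - n" n] by linarith
    then have "i + j - n = k" using j by (simp only:)
    then show ?thesis using False j assms by auto
  qed
qed

lemma latin_square_cyclic:
  "latin_square n {..<n} {(i, j, (i + j) mod n) | i j. i < n \<and> j < n}"
    (is "latin_square n _ ?L")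
proof -
  have mem: "(i, j, k) \<in> ?L \<longleftrightarrow> i < n \<and> j < n \<and> (i + j) mod n = k" for i j k
    by auto
  have "\<exists>!j. (i, j, k) \<in> ?L" if "i < n" "k < n" for i k
    unfolding mem using cyclic_unique[OF that] that by simp
  moreover have "\<exists>!i. (i, j, k) \<in> ?L" if "j < n" "k < n" for j k
    unfolding mem using cyclic_unique[OF that] that by (simp add: add.commute)
  moreover have "\<exists>!k. (i, j, k) \<in> ?L" if "i < n" "j < n" for i j
    unfolding mem using that by simp
  moreover have "?L \<subseteq> {..<n} \<times> {..<n} \<times> {..<n}"
    by auto
  ultimately show ?thesis
    unfolding latin_square_def by (simp only: lessThan_iff) simp
qed

lemma num_intercalates_nonempty:
  "{num_intercalates L | L (S :: nat set). latin_square n S L} \<noteq> {}"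
  using latin_square_cyclic by blast

end

(* Let X = Z_2^2 x Z_m x Z_2^(alpha - 2) carry the quasigroup operation

     (x, i, u) * (y, j, v) = (x + y, e(y) i + f(x, y) j, u + v),

   where e(y) = (-1)^q(y) for the anisotropic quadratic form q on Z_2^2 and f(x, y) = (-1)^w(x, y)
   for its polar form w. Fix a row (x, i, u) and a column (y, j, v). A second row (x + d, i', u') and
   a second column (y + d, j', v') complete them to an intercalate iff u + u' = v + v' and two linear
   equations in (i', j') hold. Since q(y) + q(y + d) = 1 + w(y, d) for d nonzero, these two equations
   agree up to sign whenever d is nonzero, so that every i' is possible; for d = 0 one can take
   i' = i, j' = j and u' different from u. Hence each pair of a row and a column lies in at least
   3 m 2^(alpha - 2) + 2^(alpha - 2) - 1 intercalates, and each intercalate has four such pairs. *)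

theory Submission
  imports Defs
begin

section \<open>Double counting of intercalates in a finite quasigroup\<close>

definition partner_rows :: "'a set \<Rightarrow> ('a \<Rightarrow> 'a \<Rightarrow> 'a) \<Rightarrow> 'a \<Rightarrow> 'a \<Rightarrow> 'a set" where
  "partner_rows X f r c = {r' \<in> X. r' \<noteq> r \<and> (\<exists>c'\<in>X. f r c = f r' c' \<and> f r c' = f r' c)}"

lemma inj_on_imp_ex1:
  assumes "finite X" "inj_on f X" "f ` X \<subseteq> X" "k \<in> X"
  shows "\<exists>!j. j \<in> X \<and> f j = k"
proof -
  have "f ` X = X" using assms by (simp add: endo_inj_surj)
  then show ?thesis using assms by (metis (no_types, lifting) imageE inj_onD)
qed

text \<open>Double counting of pairs of an intercalate and one of its entries: every cell
  contributes at least \<open>t\<close> such pairs, every intercalate at most four. The Cayley table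
  is a Latin square because an injective self-map of a finite set is onto.\<close>

lemma max_intercalates_nat:
  fixes f :: "nat \<Rightarrow> nat \<Rightarrow> nat"
  assumes closed: "\<And>i j. i < n \<Longrightarrow> j < n \<Longrightarrow> f i j < n"
    and inj_right: "\<And>i. i < n \<Longrightarrow> inj_on (f i) {..<n}"
    and inj_left: "\<And>j. j < n \<Longrightarrow> inj_on (\<lambda>i. f i j) {..<n}"
    and partners: "\<And>r c. r < n \<Longrightarrow> c < n \<Longrightarrow> t \<le> card (partner_rows {..<n} f r c)"
  shows "n * n * t \<le> 4 * max_intercalates n"
proof -
  define L where "L = {(i, j, f i j) | i j. i < n \<and> j < n}"
  have mem: "(i, j, k) \<in> L \<longleftrightarrow> i < n \<and> j < n \<and> f i j = k" for i j k
    by (auto simp: L_def)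
  have "\<exists>!j. (i, j, k) \<in> L" if "i < n" "k < n" for i k
    unfolding mem using inj_on_imp_ex1[of "{..<n}" "f i" k] inj_right closed that
    by (auto simp: image_subset_iff)
  moreover have "\<exists>!i. (i, j, k) \<in> L" if "j < n" "k < n" for j k
    unfolding mem using inj_on_imp_ex1[of "{..<n}" "\<lambda>i. f i j" k] inj_left closed that
    by (auto simp: image_subset_iff)
  moreover have "\<exists>!k. (i, j, k) \<in> L" if "i < n" "j < n" for i j
    unfolding mem using that by simp
  moreover have "L \<subseteq> {..<n} \<times> {..<n} \<times> {..<n}"
    using closed by (auto simp: L_def)
  ultimately have latin: "latin_square n {..<n} L"
    unfolding latin_square_def by (simp only: lessThan_iff) simp
  then have fin_L: "finite L"
    unfolding latin_square_def by (meson finite_SigmaI finite_lessThan finite_subset)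
  then have fin: "finite (intercalates L)"
    by (rule finite_subset[rotated, OF finite_Pow_iff[THEN iffD2]]) (auto simp: intercalates_def)

  define T where "T r c =
    {(r', c'). r' < n \<and> c' < n \<and> r' \<noteq> r \<and> f r c = f r' c' \<and> f r c' = f r' c}" for r c
  have fin_T: "finite (T r c)" for r c
    by (rule finite_subset[of _ "{..<n} \<times> {..<n}"]) (auto simp: T_def)
  have "t \<le> card (T r c)" if "r < n" "c < n" for r c
  proof -
    \<comment> \<open>Each partner row has some completing column, so projecting
      \<open>T r c\<close> to its rows covers them all.\<close>
    have "partner_rows {..<n} f r c \<subseteq> fst ` T r c"
      by (force simp: partner_rows_def T_def)
    then have "card (partner_rows {..<n} f r c) \<le> card (T r c)"
      using fin_T by (meson card_image_le card_mono finite_imageI le_trans)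
    then show ?thesis using partners that le_trans by blast
  qed
  then have "(\<Sum>(r, c) \<in> {..<n} \<times> {..<n}. t) \<le> (\<Sum>(r, c) \<in> {..<n} \<times> {..<n}. card (T r c))"
    by (intro sum_mono) auto
  then have "n * n * t \<le> card (Sigma ({..<n} \<times> {..<n}) (\<lambda>(r, c). T r c))"
    using fin_T by (simp add: card_SigmaI case_prod_unfold card_cartesian_product)
  also have "\<dots> \<le> card (Sigma (intercalates L) (\<lambda>Q. Q))"
  proof -
    define Q where "Q r c r' c' =
      {(r, c, f r c), (r, c', f r c'), (r', c, f r c'), (r', c', f r c)}" for r c r' c'
    \<comment> \<open>The second component marks the entry from which the intercalate was built, so
      that \<open>r\<close> and \<open>c\<close> can be read off from the image.\<close>
    define h where "h = (\<lambda>((r, c), (r', c')). (Q r c r' c', (r, c, f r c)))"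
    have "inj_on h (Sigma ({..<n} \<times> {..<n}) (\<lambda>(r, c). T r c))"
    proof (rule inj_onI, clarsimp simp: h_def)
      fix r c r1 c1 r2 c2
      assume T: "(r1, c1) \<in> T r c" "(r2, c2) \<in> T r c" and Q: "Q r c r1 c1 = Q r c r2 c2"
        and rc: "r < n" "c < n"
      \<comment> \<open>The rows occurring in \<open>Q\<close> determine the second row;
        cancellation in that row then determines the second column.\<close>
      have "{r, r1} = {r, r2}" using arg_cong[OF Q, of "\<lambda>Q. fst ` Q"] by (auto simp: Q_def)
      then have r: "r1 = r2" using T by (auto simp: T_def doubleton_eq_iff)
      have "f r1 c1 = f r1 c2" "c1 < n" "c2 < n" "r1 < n" using T r by (auto simp: T_def)
      then have "c1 = c2" using inj_right by (meson inj_onD lessThan_iff)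
      with r show "r1 = r2 \<and> c1 = c2" by simp
    qed
    moreover have "h ` Sigma ({..<n} \<times> {..<n}) (\<lambda>(r, c). T r c) \<subseteq> Sigma (intercalates L) (\<lambda>Q. Q)"
    proof (clarsimp simp: h_def)
      fix r c r' c'
      assume rc: "r < n" "c < n" and T: "(r', c') \<in> T r c"
      \<comment> \<open>If \<open>c = c'\<close>, then \<open>f r c = f r' c\<close>, and cancelling
        \<open>c\<close> would give \<open>r = r'\<close>.\<close>
      have cc: "c \<noteq> c'"
        using T rc inj_left[of c] by (auto simp: T_def dest: inj_onD)
      have rr: "r \<noteq> r'"
        and Q_eq: "Q r c r' c' = {(r, c, f r c), (r, c', f r c'), (r', c, f r c'), (r', c', f r c)}"
        using T by (simp_all add: T_def Q_def)
      have "f r c \<noteq> f r c'"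
        using T rc cc inj_right[of r] inj_onD[of "f r" "{..<n}" c c'] by (auto simp: T_def)
      moreover have "Q r c r' c' \<subseteq> L"
        using T rc by (auto simp: T_def Q_def mem)
      ultimately have "Q r c r' c' \<in> intercalates L"
        unfolding intercalates_def mem_Collect_eq using rr cc Q_eq by metis
      then show "Q r c r' c' \<in> intercalates L \<and> (r, c, f r c) \<in> Q r c r' c'"
        by (simp add: Q_def)
    qed
    moreover have "finite (Sigma (intercalates L) (\<lambda>Q. Q))"
      using fin fin_L by (auto simp: intercalates_def intro!: finite_SigmaI intro: finite_subset)
    ultimately show ?thesis by (meson card_inj_on_le)
  qed
  also have "\<dots> = (\<Sum>Q\<in>intercalates L. card Q)"
    using fin fin_L by (subst card_SigmaI) (auto simp: intercalates_def intro: finite_subset)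
  also have "\<dots> \<le> (\<Sum>Q\<in>intercalates L. 4)"
  proof (rule sum_mono)
    fix Q assume "Q \<in> intercalates L"
    then obtain a b c d where "Q = set [a, b, c, d]"
      unfolding intercalates_def by auto
    then show "card Q \<le> 4" using card_length[of "[a, b, c, d]"] by simp
  qed
  also have "\<dots> = 4 * num_intercalates L"
    by (simp add: num_intercalates_def)
  also have "num_intercalates L \<le> max_intercalates n"
    unfolding max_intercalates_def using latin finite_num_intercalates
    by (intro Max_ge) blast+
  finally show ?thesis by simp
qed

text \<open>Latin squares here have rows and columns indexed by \<open>{..<n}\<close>, so the
  operation is transported along a bijection; \<open>g\<close> carries partner rows injectively to
  partner rows.\<close>

lemma max_intercalates_quasigroup:
  fixes f :: "'a \<Rightarrow> 'a \<Rightarrow> 'a"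
  assumes fin: "finite X"
    and closed: "\<And>x y. x \<in> X \<Longrightarrow> y \<in> X \<Longrightarrow> f x y \<in> X"
    and inj_right: "\<And>x. x \<in> X \<Longrightarrow> inj_on (f x) X"
    and inj_left: "\<And>y. y \<in> X \<Longrightarrow> inj_on (\<lambda>x. f x y) X"
    and partners: "\<And>r c. r \<in> X \<Longrightarrow> c \<in> X \<Longrightarrow> t \<le> card (partner_rows X f r c)"
  shows "card X * card X * t \<le> 4 * max_intercalates (card X)"
proof -
  let ?n = "card X"
  obtain h where h: "bij_betw h {..<?n} X"
    using ex_bij_betw_nat_finite[OF fin] by (auto simp: atLeast0LessThan)
  define g where "g = inv_into {..<?n} h"
  have g: "bij_betw g X {..<?n}" unfolding g_def by (rule bij_betw_inv_into[OF h])
  have hX: "h i \<in> X" if "i < ?n" for i using h that by (auto simp: bij_betw_def)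
  have gn: "g x < ?n" if "x \<in> X" for x using g that by (auto simp: bij_betw_def)
  have hg: "h (g x) = x" if "x \<in> X" for x
    unfolding g_def using h that by (simp add: bij_betw_inv_into_right)
  have gh: "g (h i) = i" if "i < ?n" for i
    unfolding g_def using h that by (simp add: bij_betw_inv_into_left)
  have g_eq: "g x = g y \<longleftrightarrow> x = y" if "x \<in> X" "y \<in> X" for x y using hg that by metis
  have h_eq: "h i = h j \<longleftrightarrow> i = j" if "i < ?n" "j < ?n" for i j using gh that by metis
  show ?thesis
  proof (rule max_intercalates_nat[where f = "\<lambda>i j. g (f (h i) (h j))"])
    show "g (f (h i) (h j)) < ?n" if "i < ?n" "j < ?n" for i j
      using that by (simp add: gn closed hX)
    show "inj_on (\<lambda>j. g (f (h i) (h j))) {..<?n}" if "i < ?n" for i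
      using that inj_right[OF hX[OF that]]
      by (auto simp: inj_on_def g_eq h_eq closed hX) (metis h_eq hX)
    show "inj_on (\<lambda>i. g (f (h i) (h j))) {..<?n}" if "j < ?n" for j
      using that inj_left[OF hX[OF that]]
      by (auto simp: inj_on_def g_eq h_eq closed hX) (metis h_eq hX)
    show "t \<le> card (partner_rows {..<?n} (\<lambda>i j. g (f (h i) (h j))) r c)"
      if rc: "r < ?n" "c < ?n" for r c
    proof -
      have "g ` partner_rows X f (h r) (h c) \<subseteq> partner_rows {..<?n} (\<lambda>i j. g (f (h i) (h j))) r c"
      proof
        fix i assume "i \<in> g ` partner_rows X f (h r) (h c)"
        then obtain r' c' where "i = g r'" "r' \<in> X" "r' \<noteq> h r" "c' \<in> X"
          "f (h r) (h c) = f r' c'" "f (h r) c' = f r' (h c)"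
          by (auto simp: partner_rows_def)
        moreover from this have "g r' \<noteq> r" using hg by auto
        moreover have "g c' < ?n" using gn \<open>c' \<in> X\<close> by blast
        ultimately show "i \<in> partner_rows {..<?n} (\<lambda>i j. g (f (h i) (h j))) r c"
          using hg gn by (auto simp: partner_rows_def intro!: bexI[of _ "g c'"])
      qed
      moreover have "inj_on g (partner_rows X f (h r) (h c))"
        using g by (auto simp: bij_betw_def partner_rows_def intro: inj_on_subset)
      moreover have "finite (partner_rows {..<?n} (\<lambda>i j. g (f (h i) (h j))) r c)"
        by (simp add: partner_rows_def)
      ultimately have "card (partner_rows X f (h r) (h c))
          \<le> card (partner_rows {..<?n} (\<lambda>i j. g (f (h i) (h j))) r c)"
        by (meson card_inj_on_le)
      then show ?thesis using partners[of "h r" "h c"] rc hX by fastforce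
    qed
  qed
qed

section \<open>The twisted quasigroup: cancellation and completion of intercalates\<close>

type_synonym point = "(bool \<times> bool) \<times> int \<times> nat set"

definition add2 :: "bool \<times> bool \<Rightarrow> bool \<times> bool \<Rightarrow> bool \<times> bool" where
  "add2 x y = (fst x \<noteq> fst y, snd x \<noteq> snd y)"

text \<open>The form is q(a, b) = a + ab + b over Z_2, which vanishes only at the origin.\<close>

definition quad_sign :: "bool \<times> bool \<Rightarrow> int" where
  "quad_sign y = (if y = (False, False) then 1 else - 1)"

text \<open>The polar form of q is the determinant on Z_2^2; it is 1 exactly on pairs of distinct
  nonzero vectors.\<close>

definition polar_sign :: "bool \<times> bool \<Rightarrow> bool \<times> bool \<Rightarrow> int" where
  "polar_sign x y = (if x = (False, False) \<or> y = (False, False) \<or> x = y then 1 else - 1)"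

text \<open>Subsets of \<open>{..<k}\<close> under symmetric difference stand for Z_2^k, and pairs
  of booleans under \<open>add2\<close> for Z_2^2.\<close>

definition carrier :: "nat \<Rightarrow> nat \<Rightarrow> point set" where
  "carrier m k = UNIV \<times> {0..<int m} \<times> Pow {..<k}"

definition twisted_mult :: "nat \<Rightarrow> point \<Rightarrow> point \<Rightarrow> point" where
  "twisted_mult m = (\<lambda>(x, i, u) (y, j, v).
     (add2 x y, (quad_sign y * i + polar_sign x y * j) mod int m, sym_diff u v))"

lemma quad_sign_cases: "quad_sign y = 1 \<or> quad_sign y = - 1"
  by (simp add: quad_sign_def)

lemma polar_sign_cases: "polar_sign x y = 1 \<or> polar_sign x y = - 1"
  by (simp add: polar_sign_def)

lemma add2_left_cancel [simp]: "add2 x y = add2 x y' \<longleftrightarrow> y = y'"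
  by (auto simp: add2_def prod_eq_iff)

lemma add2_right_cancel [simp]: "add2 x y = add2 x' y \<longleftrightarrow> x = x'"
  by (auto simp: add2_def prod_eq_iff)

lemma sym_diff_left_cancel: "sym_diff u v = sym_diff u v' \<longleftrightarrow> v = v'"
  by blast

lemma sym_diff_right_cancel: "sym_diff u v = sym_diff u' v \<longleftrightarrow> u = u'"
  by blast

text \<open>A sign is its own inverse modulo \<open>m\<close>; the range conditions turn the
  remaining congruence into an equality.\<close>

lemma signed_mod_cancel:
  fixes s i j a m :: int
  assumes "s = 1 \<or> s = - 1" "(s * i + a) mod m = (s * j + a) mod m"
    and "0 \<le> i" "i < m" "0 \<le> j" "j < m"
  shows "i = j"
proof -
  have "m dvd s * (i - j)"
    using assms(2) by (simp add: mod_eq_dvd_iff algebra_simps)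
  then have "m dvd i - j" using assms(1) by (auto simp: dvd_diff_commute)
  then have "i mod m = j mod m" by (simp add: mod_eq_dvd_iff)
  then show ?thesis using assms by simp
qed

lemma twisted_mult_closed:
  "m > 0 \<Longrightarrow> p \<in> carrier m k \<Longrightarrow> q \<in> carrier m k \<Longrightarrow> twisted_mult m p q \<in> carrier m k"
  by (auto simp: carrier_def twisted_mult_def)

lemma inj_on_twisted_mult_right: "inj_on (twisted_mult m p) (carrier m k)"
proof (rule inj_onI)
  fix q q' :: point
  obtain x i u where p: "p = (x, i, u)" by (cases p)
  obtain y j v where q: "q = (y, j, v)" by (cases q)
  obtain y' j' v' where q': "q' = (y', j', v')" by (cases q')
  assume "q \<in> carrier m k" "q' \<in> carrier m k" "twisted_mult m p q = twisted_mult m p q'"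
  \<comment> \<open>The outer coordinates cancel first. After that both sides have the same
    coefficients, and the middle coordinate cancels too.\<close>
  then have eq: "y = y'" "v = v'" "0 \<le> j" "j < int m" "0 \<le> j'" "j' < int m"
    and "(quad_sign y * i + polar_sign x y * j) mod int m =
      (quad_sign y' * i + polar_sign x y' * j') mod int m"
    unfolding p q q' twisted_mult_def carrier_def prod.case prod.inject add2_left_cancel
      sym_diff_left_cancel mem_Sigma_iff atLeastLessThan_iff by blast+
  then have "(polar_sign x y * j + quad_sign y * i) mod int m =
      (polar_sign x y * j' + quad_sign y * i) mod int m"
    by (simp only: add.commute)
  then have "j = j'" by (rule signed_mod_cancel[OF polar_sign_cases]) (fact eq)+
  with eq show "q = q'" by (simp only: q q')
qed

lemma inj_on_twisted_mult_left: "inj_on (\<lambda>p. twisted_mult m p q) (carrier m k)"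
proof (rule inj_onI)
  fix p p' :: point
  obtain y j v where q: "q = (y, j, v)" by (cases q)
  obtain x i u where p: "p = (x, i, u)" by (cases p)
  obtain x' i' u' where p': "p' = (x', i', u')" by (cases p')
  assume "p \<in> carrier m k" "p' \<in> carrier m k" "twisted_mult m p q = twisted_mult m p' q"
  then have eq: "x = x'" "u = u'" "0 \<le> i" "i < int m" "0 \<le> i'" "i' < int m"
    and "(quad_sign y * i + polar_sign x y * j) mod int m =
      (quad_sign y * i' + polar_sign x' y * j) mod int m"
    unfolding p p' q twisted_mult_def carrier_def prod.case prod.inject add2_right_cancel
      sym_diff_right_cancel mem_Sigma_iff atLeastLessThan_iff by blast+
  then have "(quad_sign y * i + polar_sign x y * j) mod int m =
      (quad_sign y * i' + polar_sign x y * j) mod int m"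
    by (simp only:)
  then have "i = i'" by (rule signed_mod_cancel[OF quad_sign_cases]) (fact eq)+
  with eq show "p = p'" by (simp only: p p')
qed

text \<open>Put d = x + x' = y + y', which is nonzero. Bringing all terms to one side, the second
  equation times e(y) e(y') is the first, because e(y) e(y') = -f(d, y) = -f(d, y') and f is
  bimultiplicative. This holds over the integers, before any reduction modulo
  \<open>m\<close>.\<close>

lemma ex_common_solution:
  fixes i i' j :: int
  assumes "x \<noteq> x'" "add2 x x' = add2 y y'"
  shows "\<exists>j'. quad_sign y * i + polar_sign x y * j = quad_sign y' * i' + polar_sign x' y' * j' \<and>
              quad_sign y' * i + polar_sign x y' * j' = quad_sign y * i' + polar_sign x' y * j"
proof
  \<comment> \<open>The first equation solved for j', the sign \<open>polar_sign x' y'\<close> being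
    its own inverse.\<close>
  let ?j' = "polar_sign x' y' * (quad_sign y * i + polar_sign x y * j - quad_sign y' * i')"
  show "quad_sign y * i + polar_sign x y * j = quad_sign y' * i' + polar_sign x' y' * ?j' \<and>
        quad_sign y' * i + polar_sign x y' * ?j' = quad_sign y * i' + polar_sign x' y * j"
    using assms
    by (cases x; cases y; cases x'; cases y')
       (auto simp: add2_def quad_sign_def polar_sign_def)
qed

lemma partner_rows_twisted_mult:
  assumes "m > 0" "(x, i, u) \<in> carrier m k" "(y, j, v) \<in> carrier m k"
  shows "(UNIV - {x}) \<times> {0..<int m} \<times> Pow {..<k} \<union> {x} \<times> {i} \<times> (Pow {..<k} - {u})
         \<subseteq> partner_rows (carrier m k) (twisted_mult m) (x, i, u) (y, j, v)"
proof
  fix p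
  assume p: "p \<in> (UNIV - {x}) \<times> {0..<int m} \<times> Pow {..<k} \<union> {x} \<times> {i} \<times> (Pow {..<k} - {u})"
  obtain x' i' u' where p_eq: "p = (x', i', u')" by (cases p)
  \<comment> \<open>This is u + v + u' in Z_2^k, the value that both third-coordinate equations
    force.\<close>
  define v' where "v' = {a. (a \<in> u) \<noteq> ((a \<in> v) \<noteq> (a \<in> u'))}"
  have v': "v' \<subseteq> {..<k}" "sym_diff u v = sym_diff u' v'"
    "sym_diff u v' = sym_diff u' v"
    using p assms by (auto simp: v'_def p_eq carrier_def)
  have ne: "p \<noteq> (x, i, u)" and pX: "p \<in> carrier m k"
    using p assms by (auto simp: p_eq carrier_def)
  have "\<exists>c'\<in>carrier m k. twisted_mult m (x, i, u) (y, j, v) = twisted_mult m p c' \<and>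
          twisted_mult m (x, i, u) c' = twisted_mult m p (y, j, v)"
  proof (cases "x' = x")
    case True
    then have "i' = i" using p by (auto simp: p_eq)
    \<comment> \<open>With \<open>y\<close> and \<open>j\<close> kept, the first two coordinates of
      both equations agree trivially; only the subsets change.\<close>
    then show ?thesis
      using True v' assms by (intro bexI[of _ "(y, j, v')"])
        (auto simp: p_eq twisted_mult_def carrier_def)
  next
    case False
    define y' where "y' = add2 x (add2 x' y)"
    have add: "add2 x x' = add2 y y'" "add2 x y = add2 x' y'" "add2 x y' = add2 x' y"
      by (auto simp: y'_def add2_def)
    obtain J where
      J: "quad_sign y * i + polar_sign x y * j = quad_sign y' * i' + polar_sign x' y' * J"
         "quad_sign y' * i + polar_sign x y' * J = quad_sign y * i' + polar_sign x' y * j"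
      using ex_common_solution[of x x' y y' i j i'] add(1) False by blast
    \<comment> \<open>The integer solution \<open>J\<close> is reduced into
      \<open>{0..<int m}\<close> so that the second column lies in the carrier.\<close>
    have "(quad_sign y' * i' + polar_sign x' y' * (J mod int m)) mod int m =
        (quad_sign y * i + polar_sign x y * j) mod int m"
      "(quad_sign y' * i + polar_sign x y' * (J mod int m)) mod int m =
        (quad_sign y * i' + polar_sign x' y * j) mod int m"
      by (metis J mod_add_right_eq mod_mult_right_eq)+
    then show ?thesis
      using v' add assms by (intro bexI[of _ "(y', J mod int m, v')"])
        (auto simp: p_eq twisted_mult_def carrier_def)
  qed
  then show "p \<in> partner_rows (carrier m k) (twisted_mult m) (x, i, u) (y, j, v)"
    using ne pX by (simp add: partner_rows_def)
qed

section \<open>Cardinalities and the final bound\<close>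

lemma card_carrier: "card (carrier m k) = 4 * m * 2 ^ k"
  by (simp add: carrier_def card_cartesian_product card_Pow flip: UNIV_Times_UNIV)

lemma finite_carrier: "finite (carrier m k)"
  by (simp add: carrier_def)

lemma card_partner_rows_twisted_mult:
  assumes "m > 0" "r \<in> carrier m k" "c \<in> carrier m k"
  shows "3 * m * 2 ^ k + (2 ^ k - 1) \<le> card (partner_rows (carrier m k) (twisted_mult m) r c)"
proof -
  obtain x i u where r: "r = (x, i, u)" by (cases r)
  obtain y j v where c: "c = (y, j, v)" by (cases c)
  let ?A = "(UNIV - {x}) \<times> {0..<int m} \<times> Pow {..<k}"
  let ?B = "{x} \<times> {i} \<times> (Pow {..<k} - {u})"
  have "card (UNIV :: (bool \<times> bool) set) = 4"
    by (simp add: card_cartesian_product flip: UNIV_Times_UNIV)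
  then have "card (UNIV - {x}) = 3"
    by (simp add: card_Diff_singleton)
  then have "card ?A = 3 * m * 2 ^ k"
    by (simp add: card_cartesian_product card_Pow)
  moreover have "card ?B = 2 ^ k - 1"
    using assms(2) by (simp add: card_cartesian_product card_Pow r carrier_def)
  \<comment> \<open>The two families are disjoint: only the second has first coordinate
    \<open>x\<close>.\<close>
  moreover have "card (?A \<union> ?B) = card ?A + card ?B"
    by (intro card_Un_disjoint) auto
  moreover have "card (?A \<union> ?B) \<le> card (partner_rows (carrier m k) (twisted_mult m) r c)"
    using partner_rows_twisted_mult assms finite_carrier unfolding r c
    by (intro card_mono) (auto simp: partner_rows_def)
  ultimately show ?thesis by linarith
qed

theorem theorem2:
  fixes \<alpha> m :: nat
  assumes "\<alpha> \<ge> 2" and "m > 0" and "odd m"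
  shows "real (max_intercalates (2 ^ \<alpha> * m))
           \<ge> (2 ^ \<alpha> * real m)\<^sup>2 * (3 * real m * 2 ^ \<alpha> + 2 ^ \<alpha> - 4) / 16"
proof -
  obtain k where k: "\<alpha> = k + 2" using assms(1) by (metis add.commute le_Suc_ex)
  let ?X = "carrier m k" and ?t = "3 * m * 2 ^ k + (2 ^ k - 1) :: nat"
  have n: "card ?X = 2 ^ \<alpha> * m" by (simp add: card_carrier k power_add)
  have "card ?X * card ?X * ?t \<le> 4 * max_intercalates (card ?X)"
    using assms(2)
    by (intro max_intercalates_quasigroup[where f = "twisted_mult m"] finite_carrier
        twisted_mult_closed inj_on_twisted_mult_right inj_on_twisted_mult_left
        card_partner_rows_twisted_mult)
  then have "real (2 ^ \<alpha> * m * (2 ^ \<alpha> * m) * ?t) \<le> real (4 * max_intercalates (2 ^ \<alpha> * m))"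
    unfolding n of_nat_le_iff .
  \<comment> \<open>The truncated subtraction is exact since 1 \<le> 2^k.\<close>
  moreover have "real ?t = 3 * real m * 2 ^ k + 2 ^ k - 1"
    using of_nat_diff[of 1 "2 ^ k", where 'a = real]
    unfolding of_nat_add of_nat_mult by simp
  ultimately have "(2 ^ \<alpha> * real m)\<^sup>2 * (3 * real m * 2 ^ k + 2 ^ k - 1)
      \<le> 4 * real (max_intercalates (2 ^ \<alpha> * m))"
    by (simp add: power2_eq_square)
  \<comment> \<open>One factor 4 of the denominator 16 is 2^\<alpha> / 2^k; the other is the number
    of entries of an intercalate.\<close>
  moreover have "3 * real m * 2 ^ \<alpha> + 2 ^ \<alpha> - 4 = 4 * (3 * real m * 2 ^ k + 2 ^ k - 1)"
    by (simp add: k power_add)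
  moreover have "a * (4 * b) / 16 \<le> c" if "a * b \<le> 4 * c" for a b c :: real
    using that by simp
  ultimately show ?thesis by (simp only:)
qed

end
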